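(* Let $G$ be a graph on $n\ge2$ vertices such that neither $G$ nor its complement $\overline{G}$ has isolated vertices or connected components isomorphic to $K_2$. Then $$2(n-1)\ge \gamma_t(M(G))+\gamma_t(M(\overline{G}))\ge 2\left\lceil\frac{2n}{3}\right\rceil$$ and $$(n-1)^2\ge \gamma_t(M(G))\cdot\gamma_t(M(\overline{G}))\ge \left(\left\lceil\frac{2n}{3}\right\rceil\right)^2.$$
   Context: All graphs are finite and simple. $\overline{G}$ is the complement of $G$: same vertex set, with two distinct vertices adjacent iff they are not adjacent in $G$. For a graph $H$ with no isolated vertices, a total dominating set of $H$ is a set $S\subseteq V(H)$ such that every vertex of $H$ has at least one neighbor in $S$; $\gamma_t(H)$ is the minimum cardinality of a total dominating set. The middle graph $M(G)$ of a graph $G$ has vertex set $V(G)\cup E(G)$ (disjoint union), and two of its vertices $x,y$ are adjacent exactly when either $x,y\in E(G)$ are edges of $G$ sharing a common endpoint, or $x\in V(G)$, $y\in E(G)$ and $x$ is an endpoint of $y$ (no two elements of $V(G)$ are adjacent in $M(G)$). *)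

theory Defs
  imports Complex_Main "Graph_Theory.Graph_Theory"
begin

text \<open>
  A finite simple graph is a \<^locale>\<open>pair_graph\<close>: a finite vertex set together with a
  symmetric, irreflexive set of ordered pairs, so an undirected edge contributes two arcs.
\<close>

definition graph_complement :: "'a pair_pre_digraph \<Rightarrow> 'a pair_pre_digraph" where
  "graph_complement G = \<lparr> pverts = pverts G,
     parcs = {(u, v). u \<in> pverts G \<and> v \<in> pverts G \<and> u \<noteq> v \<and> (u, v) \<notin> parcs G} \<rparr>"

definition uedges :: "'a pair_pre_digraph \<Rightarrow> 'a set set" where
  "uedges G = {{u, v} | u v. (u, v) \<in> parcs G}"

definition isolated :: "'a pair_pre_digraph \<Rightarrow> 'a \<Rightarrow> bool" where
  "isolated G v \<longleftrightarrow> v \<in> pverts G \<and> \<not> (\<exists>u \<in> pverts G. (v, u) \<in> parcs G)"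

text \<open>
  The library provides \<open>sccs\<close> (strongly connected components); the following is the analogous
  definition for (undirected) connectedness.  The name \<open>connected\<close> is qualified because it is also
  the topological notion.
\<close>

definition components :: "('a, 'b) pre_digraph \<Rightarrow> ('a, 'b) pre_digraph set" where
  "components G = {H. induced_subgraph H G \<and> Digraph_Component.connected H \<and>
     \<not> (\<exists>H'. induced_subgraph H' G \<and> Digraph_Component.connected H' \<and> verts H \<subset> verts H')}"

text \<open>
  The predicate \<open>complete_digraph 2\<close> holds exactly of the graphs isomorphic to $K_2$.
\<close>

definition has_K2_component :: "'a pair_pre_digraph \<Rightarrow> bool" where
  "has_K2_component G \<longleftrightarrow> (\<exists>H \<in> components (with_proj G). complete_digraph 2 H)"

definition total_dominating_set :: "'a pair_pre_digraph \<Rightarrow> 'a set \<Rightarrow> bool" where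
  "total_dominating_set H S \<longleftrightarrow>
     S \<subseteq> pverts H \<and> (\<forall>v \<in> pverts H. \<exists>u \<in> S. (v, u) \<in> parcs H)"

text \<open>
  Meaningful for finite graphs without isolated vertices; otherwise there is no total dominating
  set and the value is unspecified.  Middle graphs of graphs without isolated vertices qualify
  (see \<open>total_domination_number_attained_middle\<close> below).
\<close>

definition total_domination_number :: "'a pair_pre_digraph \<Rightarrow> nat" where
  "total_domination_number H = (LEAST k. \<exists>S. total_dominating_set H S \<and> card S = k)"

definition middle_graph :: "'a pair_pre_digraph \<Rightarrow> ('a + 'a set) pair_pre_digraph" where
  "middle_graph G = \<lparr> pverts = pverts G <+> uedges G,
     parcs = {(Inr e, Inr f) | e f. e \<in> uedges G \<and> f \<in> uedges G \<and> e \<noteq> f \<and> e \<inter> f \<noteq> {}}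
           \<union> {(Inl v, Inr e) | v e. v \<in> pverts G \<and> e \<in> uedges G \<and> v \<in> e}
           \<union> {(Inr e, Inl v) | v e. v \<in> pverts G \<and> e \<in> uedges G \<and> v \<in> e} \<rparr>"

lemma pair_graph_iff:
  "pair_graph G \<longleftrightarrow> finite (pverts G) \<and> parcs G \<subseteq> pverts G \<times> pverts G \<and>
     sym (parcs G) \<and> irrefl (parcs G)"
proof
  assume "pair_graph G"
  then interpret pair_graph G .
  show "finite (pverts G) \<and> parcs G \<subseteq> pverts G \<times> pverts G \<and>
     sym (parcs G) \<and> irrefl (parcs G)"
    using pair_finite_verts in_arcsD1 in_arcsD2 pair_sym_arcs pair_no_loops
    by (fastforce simp: symmetric_def irrefl_def)
next
  assume "finite (pverts G) \<and> parcs G \<subseteq> pverts G \<times> pverts G \<and>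
     sym (parcs G) \<and> irrefl (parcs G)"
  then show "pair_graph G"
    by unfold_locales
      (auto simp: symmetric_def irrefl_def intro: finite_subset[of _ "pverts G \<times> pverts G"])
qed

lemma pair_graph_complement: "pair_graph G \<Longrightarrow> pair_graph (graph_complement G)"
  by (auto simp: pair_graph_iff graph_complement_def sym_def irrefl_def)

lemma pair_graph_middle:
  assumes "pair_graph G"
  shows "pair_graph (middle_graph G)"
proof -
  have "uedges G \<subseteq> Pow (pverts G)"
    using assms by (auto simp: pair_graph_iff uedges_def)
  then have "finite (uedges G)"
    using assms by (meson finite_Pow_iff finite_subset pair_graph_iff)
  then show ?thesis
    using assms by (auto simp: pair_graph_iff middle_graph_def sym_def irrefl_def)
qed

lemma middle_no_isolated:
  assumes "pair_graph G" "\<forall>v. \<not> isolated G v"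
  shows "\<not> isolated (middle_graph G) x"
proof (cases x)
  case (Inl v)
  then show ?thesis
    using assms(2)[rule_format, of v]
    by (auto simp: isolated_def middle_graph_def uedges_def)
next
  case (Inr e)
  show ?thesis
  proof
    assume iso: "isolated (middle_graph G) x"
    then have e: "e \<in> uedges G"
      using Inr by (auto simp: isolated_def middle_graph_def)
    then obtain u where u: "u \<in> e" "u \<in> pverts G"
      using assms(1) unfolding uedges_def pair_graph_iff by blast
    have "Inl u \<in> pverts (middle_graph G)" "(Inr e, Inl u) \<in> parcs (middle_graph G)"
      using e u by (auto simp: middle_graph_def)
    then show False
      using iso Inr unfolding isolated_def by blast
  qed
qed

lemma total_domination_number_attained:
  assumes "\<forall>v. \<not> isolated H v"
  shows "\<exists>S. total_dominating_set H S \<and> card S = total_domination_number H"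
proof -
  have "total_dominating_set H (pverts H)"
    using assms by (auto simp: total_dominating_set_def isolated_def)
  then have "\<exists>k S. total_dominating_set H S \<and> card S = k"
    by blast
  then show ?thesis
    unfolding total_domination_number_def by (rule LeastI_ex)
qed

lemma total_domination_number_attained_middle:
  assumes "pair_graph G" "\<forall>v. \<not> isolated G v"
  shows "\<exists>S. total_dominating_set (middle_graph G) S \<and>
    card S = total_domination_number (middle_graph G)"
  using total_domination_number_attained middle_no_isolated[OF assms] by blast

end

theory Submission
  imports Defs
begin

text \<open>
  Put $S = V' \cup F$ with $V' \subseteq V(G)$, $F \subseteq E(G)$.  A vertex of $G$ is dominated in
  $M(G)$ only by an edge of $F$, and an edge of $F$ whose two ends have $F$-degree one must have an
  end in $V'$.  Hence the vertices of $F$-degree one outside $V'$ inject into $F$, and summing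
  $F$-degrees gives $2n \le 3|F| + |V'| \le 3|S|$.  Conversely, an edge set that covers $V(G)$ and in
  which every edge meets another one is total dominating; one with at most $n - 1$ edges is grown
  from the empty set by appending pendant edges and disjoint paths with two edges.  Such a path is
  available outside the covered set as long as no component is a single vertex or edge.
\<close>

section \<open>Undirected edges as two-element sets\<close>

lemma uedges_iff_arc:
  assumes "pair_graph G"
  shows "{u, v} \<in> uedges G \<longleftrightarrow> (u, v) \<in> parcs G"
  using assms by (auto simp: uedges_def pair_graph_iff doubleton_eq_iff sym_def)

lemma uedgesE:
  assumes "e \<in> uedges G" "pair_graph G"
  obtains u v where "e = {u, v}" "u \<noteq> v" "(u, v) \<in> parcs G" "u \<in> pverts G" "v \<in> pverts G"
  using assms unfolding uedges_def pair_graph_iff irrefl_def by blast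

lemma finite_uedges:
  assumes "pair_graph G"
  shows "finite (uedges G)"
proof -
  have "uedges G \<subseteq> Pow (pverts G)"
    using assms by (auto elim: uedgesE)
  then show ?thesis
    using assms by (meson finite_Pow_iff finite_subset pair_graph_iff)
qed

section \<open>Components isomorphic to K_2 and paths with two edges\<close>

lemma reachable_closed_set:
  assumes "u \<rightarrow>\<^sup>*\<^bsub>H\<^esub> w" "u \<in> U" "\<And>x y. (x, y) \<in> arcs_ends H \<Longrightarrow> x \<in> U \<Longrightarrow> y \<in> U"
  shows "w \<in> U"
  using assms(1)[unfolded reachable_def] assms(2)
  by (induction rule: rtrancl_on_induct) (auto intro: assms(3))

text \<open>Replaces maximality among connected induced subgraphs by a condition on neighbours. As
  \<open>u\<close> and \<open>v\<close> are adjacent only to each other, no walk leaves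
  \<open>{u, v}\<close>, so no connected induced subgraph properly contains this pair.\<close>

lemma has_K2_componentI:
  assumes G: "pair_graph G" and uv: "(u, v) \<in> parcs G"
    and closed: "\<And>w. (u, w) \<in> parcs G \<Longrightarrow> w = v" "\<And>w. (v, w) \<in> parcs G \<Longrightarrow> w = u"
  shows "has_K2_component G"
proof -
  define K where "K = \<lparr>pverts = {u, v}, parcs = {(u, v), (v, u)}\<rparr>"
  have arcs: "u \<noteq> v" "u \<in> pverts G" "v \<in> pverts G" "(v, u) \<in> parcs G"
      "(x, x) \<notin> parcs G" for x
    using G uv by (auto simp: pair_graph_iff irrefl_def sym_def)
  have K: "pair_graph K"
    using arcs by (auto simp: K_def pair_graph_iff sym_def irrefl_def)
  then interpret K: pair_graph K .
  interpret G: pair_graph G by (rule G)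
  have "induced_subgraph (with_proj K) (with_proj G)"
    using arcs uv K.wf_digraph_axioms G.wf_digraph_axioms
    by (auto simp: induced_subgraph_def subgraph_def K_def)
  moreover have "Digraph_Component.connected (with_proj K)"
  proof -
    have "x \<rightarrow>\<^sup>*\<^bsub>with_proj (mk_symmetric (with_proj K))\<^esub> y"
      if "x \<in> pverts K" "y \<in> pverts K" for x y
    \<comment> \<open>Connectedness is strong connectedness of the symmetric closure, so paths in
      \<open>K\<close> itself suffice.\<close>
    proof (rule K.reachable_mk_symmetricI)
      have "x = y \<or> x \<rightarrow>\<^bsub>with_proj K\<^esub> y" using that by (auto simp: K_def)
      then show "x \<rightarrow>\<^sup>*\<^bsub>with_proj K\<^esub> y"
        using that(1) K.reachable_adjI by auto
    qed
    moreover have "pverts K \<noteq> {}" by (simp add: K_def)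
    ultimately show ?thesis
      by (simp add: connected_def strongly_connected_def)
  qed
  moreover have "\<not> verts (with_proj K) \<subset> verts H"
    if H: "induced_subgraph H (with_proj G)" and con: "Digraph_Component.connected H" for H
  proof
    assume sub: "verts (with_proj K) \<subset> verts H"
    then obtain w where w: "w \<in> verts H" "w \<notin> {u, v}" by (auto simp: K_def)
    have sub_arcs: "arcs H \<subseteq> parcs G" "tail H = fst" "head H = snd"
      using H by (auto simp: induced_subgraph_def subgraph_def compatible_def)
    have "u \<rightarrow>\<^sup>*\<^bsub>with_proj (mk_symmetric H)\<^esub> w"
      using con w sub by (auto simp: connected_def strongly_connected_def K_def)
    then have "w \<in> {u, v}"
    proof (rule reachable_closed_set)
      fix x y assume "(x, y) \<in> arcs_ends (with_proj (mk_symmetric H))" and x: "x \<in> {u, v}"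
      \<comment> \<open>Since \<open>G\<close> is symmetric, the symmetric closure of
        \<open>H\<close> has no arc outside \<open>G\<close>.\<close>
      then have "(x, y) \<in> parcs G"
        using sub_arcs G by (auto simp: parcs_mk_symmetric pair_graph_iff sym_def)
      then show "y \<in> {u, v}" using x closed by blast
    qed simp
    then show False using w by simp
  qed
  moreover have "complete_digraph 2 (with_proj K)"
    using arcs by (auto simp: complete_digraph_pair_def K_def)
  ultimately show ?thesis
    unfolding has_K2_component_def components_def by blast
qed

text \<open>Take a neighbour \<open>u\<close> of \<open>v\<close>. If \<open>u\<close> has a second
  neighbour, the path starts at \<open>v\<close>; otherwise \<open>v\<close> has one, as the edge
  would else be a component, and \<open>v\<close> is the middle. The end \<open>c\<close> needs no
  case of its own because paths can be reversed.\<close>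

lemma two_arcs_from_vertex:
  assumes G: "pair_graph G" and iso: "\<not> isolated G v" and K2: "\<not> has_K2_component G"
    and v: "v \<in> pverts G"
  obtains a b c where "(a, b) \<in> parcs G" "(b, c) \<in> parcs G" "a \<noteq> c" "v = a \<or> v = b"
proof -
  have sym: "(x, y) \<in> parcs G \<Longrightarrow> (y, x) \<in> parcs G" for x y
    using G by (auto simp: pair_graph_iff sym_def)
  obtain u where vu: "(v, u) \<in> parcs G"
    using iso v unfolding isolated_def by blast
  show thesis
  proof (cases "\<exists>w. (u, w) \<in> parcs G \<and> w \<noteq> v")
    case True
    then show thesis using that vu by blast
  next
    case False
    then obtain w where "(v, w) \<in> parcs G" "w \<noteq> u"
      using has_K2_componentI[OF G vu] K2 by blast
    then show thesis using that[of u v w] sym vu by blast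
  qed
qed

section \<open>Upper bound: growing an edge cover with fewer edges than vertices\<close>

text \<open>
  The truncated bound also admits the empty edge set, from which the growing process starts.
\<close>

definition forest_like_cover :: "'a pair_pre_digraph \<Rightarrow> 'a set set \<Rightarrow> bool" where
  "forest_like_cover G F \<longleftrightarrow> F \<subseteq> uedges G \<and> card F \<le> card (\<Union>F) - 1 \<and>
     (\<forall>e\<in>F. \<exists>f\<in>F. f \<noteq> e \<and> e \<inter> f \<noteq> {})"

lemma forest_like_cover_subset:
  assumes G: "pair_graph G" and F: "forest_like_cover G F"
  shows "\<Union>F \<subseteq> pverts G"
proof
  fix v assume "v \<in> \<Union>F"
  then obtain e where "e \<in> uedges G" "v \<in> e" using F by (auto simp: forest_like_cover_def)
  then show "v \<in> pverts G" using G by (auto elim: uedgesE)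
qed

lemma finite_forest_like_cover:
  assumes G: "pair_graph G" and F: "forest_like_cover G F"
  shows "finite F" "finite (\<Union>F)"
proof -
  show "finite F"
    using F finite_uedges[OF G] finite_subset by (auto simp: forest_like_cover_def)
  show "finite (\<Union>F)"
    using forest_like_cover_subset[OF assms] G finite_subset by (auto simp: pair_graph_iff)
qed

text \<open>At most one edge is added against exactly one new vertex, and the new edge meets an old
  one at the covered end \<open>w\<close>.\<close>

lemma forest_like_cover_pendant:
  assumes G: "pair_graph G" and F: "forest_like_cover G F"
    and e: "(w, v) \<in> parcs G" "w \<in> \<Union>F" "v \<notin> \<Union>F"
  shows "forest_like_cover G (insert {w, v} F)"
proof -
  have fin: "finite F" "finite (\<Union>F)"
    using finite_forest_like_cover[OF G F] by simp_all
  have un: "\<Union>(insert {w, v} F) = insert v (\<Union>F)" using e by auto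
  obtain f where f: "f \<in> F" "w \<in> f" using e by auto
  have "f \<noteq> {w, v}" using e f by auto
  then have "\<forall>d\<in>insert {w, v} F. \<exists>f\<in>insert {w, v} F. f \<noteq> d \<and> d \<inter> f \<noteq> {}"
    using F f unfolding forest_like_cover_def by blast
  moreover have "card (insert {w, v} F) \<le> card (insert v (\<Union>F)) - 1"
  proof -
    \<comment> \<open>Subtraction is truncated: the bound grows by one only if some vertex is
      already covered.\<close>
    have "card (\<Union>F) > 0" using fin e by (auto simp: card_gt_0_iff)
    moreover have "card F \<le> card (\<Union>F) - 1" using F by (simp add: forest_like_cover_def)
    moreover have "card (insert v (\<Union>F)) = card (\<Union>F) + 1"
      using fin(2) e(3) by (simp del: Union_iff)
    moreover have "card (insert {w, v} F) \<le> card F + 1"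
      using fin(1) by (simp add: card_insert_if)
    ultimately show ?thesis by linarith
  qed
  ultimately show ?thesis
    using F e uedges_iff_arc[OF G, of w v] unfolding forest_like_cover_def un by simp
qed

text \<open>Two edges against three new vertices leave one to spare, which absorbs the truncation
  when \<open>F\<close> is empty. The two edges meet each other at \<open>b\<close>, so neither
  depends on \<open>F\<close>.\<close>

lemma forest_like_cover_path:
  assumes G: "pair_graph G" and F: "forest_like_cover G F"
    and path: "(a, b) \<in> parcs G" "(b, c) \<in> parcs G" "a \<noteq> c"
    and out: "a \<notin> \<Union>F" "b \<notin> \<Union>F" "c \<notin> \<Union>F"
  shows "forest_like_cover G (insert {a, b} (insert {b, c} F))" (is "forest_like_cover G ?F")
proof -
  have fin: "finite F" "finite (\<Union>F)"
    using finite_forest_like_cover[OF G F] by simp_all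
  have ne: "a \<noteq> b" "b \<noteq> c"
    using G path by (auto simp: pair_graph_iff irrefl_def)
  have un: "\<Union>?F = insert a (insert b (insert c (\<Union>F)))" by auto
  have edges_ne: "{a, b} \<noteq> {b, c}" using ne path by (auto simp: doubleton_eq_iff)
  have meet: "\<forall>d\<in>?F. \<exists>f\<in>?F. f \<noteq> d \<and> d \<inter> f \<noteq> {}"
  proof (intro ballI)
    fix d assume "d \<in> ?F"
    then consider "d = {a, b}" | "d = {b, c}" | "d \<in> F" by auto
    then show "\<exists>f\<in>?F. f \<noteq> d \<and> d \<inter> f \<noteq> {}"
    proof cases
      case 1
      then show ?thesis using edges_ne by (intro bexI[of _ "{b, c}"]) auto
    next
      case 2
      then show ?thesis using edges_ne by (intro bexI[of _ "{a, b}"]) auto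
    next
      case 3
      then show ?thesis using F unfolding forest_like_cover_def by (meson insertCI)
    qed
  qed
  have size: "card ?F \<le> card (insert a (insert b (insert c (\<Union>F)))) - 1"
  proof -
    have "card ?F \<le> card F + 2"
      using fin by (simp add: card_insert_if)
    moreover have "card (insert a (insert b (insert c (\<Union>F)))) = card (\<Union>F) + 3"
      using fin(2) out ne path(3) by (simp add: card_insert_if del: Union_iff)
    moreover have "card F \<le> card (\<Union>F) - 1" using F by (simp add: forest_like_cover_def)
    ultimately show ?thesis by linarith
  qed
  show ?thesis
    using F path meet size uedges_iff_arc[OF G] unfolding forest_like_cover_def un by simp
qed

text \<open>An inclusion-maximal \<open>F\<close> works: no pendant edge can be added, so the
  covered set is a union of components, and a two-edge path in an uncovered component would enlarge
  \<open>F\<close>.\<close>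

lemma exists_spanning_forest_like_cover:
  assumes G: "pair_graph G" and iso: "\<forall>v. \<not> isolated G v" and K2: "\<not> has_K2_component G"
  obtains F where "forest_like_cover G F" "\<Union>F = pverts G"
proof -
  let ?C = "{F. forest_like_cover G F}"
  have sym: "(x, y) \<in> parcs G \<Longrightarrow> (y, x) \<in> parcs G" for x y
    using G by (auto simp: pair_graph_iff sym_def)
  have "finite ?C"
    using finite_uedges[OF G]
    by (auto simp: forest_like_cover_def intro: finite_subset[of _ "Pow (uedges G)"])
  moreover have "{} \<in> ?C" by (simp add: forest_like_cover_def)
  ultimately obtain F where F: "forest_like_cover G F"
    and max: "\<And>F'. forest_like_cover G F' \<Longrightarrow> F \<subseteq> F' \<Longrightarrow> F' = F"
    using finite_has_maximal[of ?C] by blast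
  have closed: "v \<in> \<Union>F" if "(w, v) \<in> parcs G" "w \<in> \<Union>F" for v w
  proof (rule ccontr)
    assume "v \<notin> \<Union>F"
    then have "{w, v} \<in> F"
      using max[OF forest_like_cover_pendant[OF G F that]] by blast
    then show False using \<open>v \<notin> \<Union>F\<close> by blast
  qed
  have "v \<in> \<Union>F" if v: "v \<in> pverts G" for v
  proof (rule ccontr)
    assume out: "v \<notin> \<Union>F"
    obtain a b c where abc: "(a, b) \<in> parcs G" "(b, c) \<in> parcs G" "a \<noteq> c" "v = a \<or> v = b"
      using two_arcs_from_vertex[OF G iso[rule_format] K2 v] .
    \<comment> \<open>By \<open>closed\<close> and symmetry, one covered vertex on the path would
      make all three covered, including \<open>v\<close>.\<close>
    then have "a \<notin> \<Union>F" "b \<notin> \<Union>F" "c \<notin> \<Union>F"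
      using out closed sym by metis+
    moreover from this have "{a, b} \<in> F"
      using max[OF forest_like_cover_path[OF G F abc(1-3)]] by blast
    ultimately show False by blast
  qed
  then show thesis using that[OF F] forest_like_cover_subset[OF G F] by blast
qed

lemma total_domination_number_le:
  assumes "total_dominating_set H S"
  shows "total_domination_number H \<le> card S"
  unfolding total_domination_number_def using assms by (blast intro: Least_le)

lemma total_domination_number_middle_le:
  assumes G: "pair_graph G" and iso: "\<forall>v. \<not> isolated G v" and K2: "\<not> has_K2_component G"
  shows "total_domination_number (middle_graph G) \<le> card (pverts G) - 1"
proof -
  obtain F where F: "forest_like_cover G F" and cov: "\<Union>F = pverts G"
    using exists_spanning_forest_like_cover[OF assms] .
  have sub: "F \<subseteq> uedges G" using F by (simp add: forest_like_cover_def)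
  have "total_dominating_set (middle_graph G) (Inr ` F)"
    unfolding total_dominating_set_def
  proof (intro conjI ballI)
    show "Inr ` F \<subseteq> pverts (middle_graph G)"
      using sub by (auto simp: middle_graph_def)
  next
    fix x assume x: "x \<in> pverts (middle_graph G)"
    show "\<exists>y\<in>Inr ` F. (x, y) \<in> parcs (middle_graph G)"
    proof (cases x)
      case (Inl v)
      then have v: "v \<in> pverts G" using x by (auto simp: middle_graph_def)
      then obtain e where "e \<in> F" "v \<in> e" using cov by blast
      then show ?thesis using sub v Inl by (auto simp: middle_graph_def)
    next
      case (Inr e)
      then have e: "e \<in> uedges G" using x by (auto simp: middle_graph_def)
      obtain f where "f \<in> F" "f \<noteq> e" "e \<inter> f \<noteq> {}"
      proof (cases "e \<in> F")
        case True
        then obtain f where "f \<in> F" "f \<noteq> e" "e \<inter> f \<noteq> {}"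
          using F unfolding forest_like_cover_def by blast
        then show thesis by (rule that)
      next
        \<comment> \<open>Any edge of \<open>F\<close> through an end of \<open>e\<close> differs
          from \<open>e\<close>, because \<open>e\<close> is outside \<open>F\<close>.\<close>
        case False
        obtain u v where uv: "e = {u, v}" "u \<noteq> v" "(u, v) \<in> parcs G" "u \<in> pverts G" "v \<in> pverts G"
          using e G by (rule uedgesE)
        then obtain f where "f \<in> F" "u \<in> f" using cov by blast
        then show thesis using that uv(1) False by blast
      qed
      then show ?thesis using sub e Inr by (auto simp: middle_graph_def)
    qed
  qed
  then have "total_domination_number (middle_graph G) \<le> card (Inr ` F :: ('a + 'a set) set)"
    by (rule total_domination_number_le)
  also have "\<dots> = card F" by (simp add: card_image)
  also have "\<dots> \<le> card (pverts G) - 1" using F cov by (simp add: forest_like_cover_def)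
  finally show ?thesis .
qed

section \<open>Lower bound: counting \<open>F\<close>-degrees\<close>

lemma card_total_dominating_set_middle:
  assumes G: "pair_graph G" and S: "total_dominating_set (middle_graph G) S"
  shows "2 * card (pverts G) \<le> 3 * card S"
proof -
  define V where "V = {v. Inl v \<in> S}"
  define F where "F = {e. Inr e \<in> S}"
  define d where "d v = card {e \<in> F. v \<in> e}" for v
  \<comment> \<open>\<open>L\<close> holds the vertices whose degree falls short of two without
    compensation from \<open>V\<close>.\<close>
  define L where "L = {v \<in> pverts G. v \<notin> V \<and> d v = 1}"
  have "S = V <+> F"
    by (auto simp: V_def F_def Plus_def image_iff) (metis sum.exhaust)
  have V: "V \<subseteq> pverts G" and F: "F \<subseteq> uedges G"
    using S by (auto simp: total_dominating_set_def middle_graph_def V_def F_def)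
  have finG: "finite (pverts G)" using G by (simp add: pair_graph_iff)
  have fin: "finite V" "finite F" "finite L"
    using V F finG finite_uedges[OF G] by (auto intro: finite_subset simp: L_def)
  have cardS: "card S = card V + card F"
    using \<open>S = V <+> F\<close> fin by (simp add: card_Plus)
  have dpos: "1 \<le> d v" if v: "v \<in> pverts G" for v
  proof -
    have "Inl v \<in> pverts (middle_graph G)" using v by (auto simp: middle_graph_def)
    then obtain x where "x \<in> S" "(Inl v, x) \<in> parcs (middle_graph G)"
      using S unfolding total_dominating_set_def by blast
    then obtain e where "e \<in> F" "v \<in> e" by (auto simp: middle_graph_def F_def)
    then have "{e \<in> F. v \<in> e} \<noteq> {}" by blast
    then show ?thesis using fin(2) by (simp add: d_def Suc_le_eq card_gt_0_iff)
  qed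
  have "\<forall>v\<in>L. \<exists>e. {f \<in> F. v \<in> f} = {e}"
    by (auto simp: L_def d_def card_1_singleton_iff)
  then obtain h where h: "\<And>v. v \<in> L \<Longrightarrow> {f \<in> F. v \<in> f} = {h v}" by metis
  have hF: "h v \<in> F" "v \<in> h v" "f \<in> F \<Longrightarrow> v \<in> f \<Longrightarrow> f = h v" if "v \<in> L" for v f
    using h[OF that] by blast+
  \<comment> \<open>If two vertices of \<open>L\<close> shared their edge, they would be its two
    ends. Nothing in \<open>S\<close> would then dominate that edge: neither end is in
    \<open>V\<close>, and no other edge of \<open>F\<close> touches either end.\<close>
  have "inj_on h L"
  proof (rule inj_onI, rule ccontr)
    fix v w assume v: "v \<in> L" and w: "w \<in> L" and eq: "h v = h w" and ne: "v \<noteq> w"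
    have "h v \<in> uedges G" using hF(1)[OF v] F by blast
    then obtain a b where "h v = {a, b}" by (auto simp: uedges_def)
    then have e: "h v = {v, w}"
      using hF(2)[OF v] hF(2)[OF w] eq ne by auto
    have "Inr (h v) \<in> pverts (middle_graph G)"
      using hF(1)[OF v] F by (auto simp: middle_graph_def)
    then obtain x where x: "x \<in> S" "(Inr (h v), x) \<in> parcs (middle_graph G)"
      using S unfolding total_dominating_set_def by blast
    show False
    proof (cases x)
      case (Inl u)
      then have "u \<in> V" "u \<in> h v" using x by (auto simp: V_def middle_graph_def)
      then show False using e v w by (auto simp: L_def)
    next
      case (Inr f)
      then have "f \<in> F" "f \<noteq> h v" "h v \<inter> f \<noteq> {}" using x by (auto simp: F_def middle_graph_def)
      then show False using e eq hF(3)[OF v] hF(3)[OF w] by auto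
    qed
  qed
  then have LF: "card L \<le> card F"
    using hF(1) fin(2) by (intro card_inj_on_le[of h]) auto
  have "card {v \<in> pverts G. v \<in> e} = 2" if "e \<in> F" for e
  proof -
    have "e \<in> uedges G" using that F by blast
    then obtain a b where "e = {a, b}" "a \<noteq> b" "a \<in> pverts G" "b \<in> pverts G"
      using G by (blast elim: uedgesE)
    moreover from this have "{v \<in> pverts G. v \<in> e} = {a, b}" by auto
    ultimately show ?thesis by simp
  qed
  \<comment> \<open>Double counting of incidences: each edge of \<open>F\<close> has exactly two
    ends in \<open>G\<close>.\<close>
  then have handshake: "(\<Sum>v\<in>pverts G. d v) = 2 * card F"
    unfolding d_def using finG fin(2) by (intro sum_multicount) auto
  have "2 * card (pverts G) = (\<Sum>v\<in>pverts G. 2)" by simp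
  also have "\<dots> \<le> (\<Sum>v\<in>pverts G. d v + of_bool (v \<in> L) + of_bool (v \<in> V))"
  proof (rule sum_mono)
    fix v assume v: "v \<in> pverts G"
    \<comment> \<open>A vertex of degree one lies in \<open>L\<close> or in \<open>V\<close>, so one
      of the indicators supplies the missing unit.\<close>
    show "2 \<le> d v + of_bool (v \<in> L) + of_bool (v \<in> V)"
      using dpos[OF v] v by (auto simp: L_def of_bool_def)
  qed
  also have "\<dots> = 2 * card F + card L + card V"
  proof -
    have "pverts G \<inter> L = L" "pverts G \<inter> V = V" using V by (auto simp: L_def)
    then show ?thesis using finG by (simp add: sum.distrib handshake)
  qed
  also have "\<dots> \<le> 3 * card S" using LF cardS by simp
  finally show ?thesis .
qed

lemma total_domination_number_middle_ge:
  assumes G: "pair_graph G" and iso: "\<forall>v. \<not> isolated G v"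
  shows "\<lceil>2 * real (card (pverts G)) / 3\<rceil> \<le> int (total_domination_number (middle_graph G))"
proof -
  \<comment> \<open>Without isolated vertices the minimum is attained, so the counting bound applies
    to a set of exactly this size.\<close>
  obtain S where "total_dominating_set (middle_graph G) S"
    and card: "card S = total_domination_number (middle_graph G)"
    using total_domination_number_attained_middle[OF assms] by blast
  then have "2 * card (pverts G) \<le> 3 * total_domination_number (middle_graph G)"
    using card_total_dominating_set_middle[OF G] by metis
  then have "2 * real (card (pverts G)) \<le> 3 * real (total_domination_number (middle_graph G))"
    by linarith
  then show ?thesis by (simp add: ceiling_le_iff)
qed

section \<open>Combining the bounds for \<open>G\<close> and its complement\<close>

theorem theorem5p1:
  fixes G :: "'a pair_pre_digraph" and n :: nat
  assumes "pair_graph G"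
    and "card (pverts G) = n"
    and "n \<ge> 2"
    and "\<forall>v. \<not> isolated G v"
    and "\<not> has_K2_component G"
    and "\<forall>v. \<not> isolated (graph_complement G) v"
    and "\<not> has_K2_component (graph_complement G)"
  shows "2 * (int n - 1) \<ge> int (total_domination_number (middle_graph G))
           + int (total_domination_number (middle_graph (graph_complement G)))
    \<and> int (total_domination_number (middle_graph G))
           + int (total_domination_number (middle_graph (graph_complement G)))
        \<ge> 2 * \<lceil>2 * real n / 3\<rceil>
    \<and> (int n - 1)\<^sup>2 \<ge> int (total_domination_number (middle_graph G))
           * int (total_domination_number (middle_graph (graph_complement G)))
    \<and> int (total_domination_number (middle_graph G))
           * int (total_domination_number (middle_graph (graph_complement G)))
        \<ge> \<lceil>2 * real n / 3\<rceil>\<^sup>2"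
proof -
  let ?a = "int (total_domination_number (middle_graph G))"
  let ?b = "int (total_domination_number (middle_graph (graph_complement G)))"
  have G': "pair_graph (graph_complement G)"
    using assms(1) by (rule pair_graph_complement)
  have n': "card (pverts (graph_complement G)) = n"
    using assms(2) by (simp add: graph_complement_def)
  \<comment> \<open>As \<open>n\<close> is at least 2, the truncated difference \<open>n - 1\<close>
    agrees with the integer one.\<close>
  have upper: "?a \<le> int n - 1" "?b \<le> int n - 1"
    using total_domination_number_middle_le[OF assms(1,4,5)]
      total_domination_number_middle_le[OF G' assms(6,7)] assms(2,3) n' by linarith+
  have lower: "\<lceil>2 * real n / 3\<rceil> \<le> ?a" "\<lceil>2 * real n / 3\<rceil> \<le> ?b"
    using total_domination_number_middle_ge[OF assms(1,4)]
      total_domination_number_middle_ge[OF G' assms(6)] assms(2) n' by simp_all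
  \<comment> \<open>Multiplying the two lower bounds requires a nonnegative ceiling.\<close>
  have "0 \<le> 2 * real n / 3" by simp
  then have "0 \<le> \<lceil>2 * real n / 3\<rceil>" by linarith
  then have "\<lceil>2 * real n / 3\<rceil>\<^sup>2 \<le> ?a * ?b"
    unfolding power2_eq_square using lower by (intro mult_mono) auto
  moreover have "?a * ?b \<le> (int n - 1)\<^sup>2"
    unfolding power2_eq_square using upper assms(3) by (intro mult_mono) auto
  moreover have "?a + ?b \<le> 2 * (int n - 1)" "2 * \<lceil>2 * real n / 3\<rceil> \<le> ?a + ?b"
    using add_mono[OF upper] add_mono[OF lower] by simp_all
  ultimately show ?thesis by blast
qed

end
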